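(* There exists a malnormal subgroup $H$ of the free group $F_2$ such that for every prime $p$, $H$ is not closed in the pro-$p$ topology on $F_2$.
   Context: A subgroup $H$ of $G$ is malnormal if for every $g\in G\setminus H$ we have $H\cap gHg^{-1}=\{1\}$. For a prime $p$, the pro-$p$ topology on $F_2$ is the group topology whose basic open sets are the cosets of normal subgroups of $F_2$ of finite index a power of $p$. *)

theory Defs
  imports "HOL-Algebra.Coset" "HOL-Analysis.Abstract_Topology"
    "HOL-Computational_Algebra.Primes"
begin

text \<open>The letter \<open>(a, True)\<close> stands for the generator \<open>a\<close> and \<open>(a, False)\<close> for its inverse.\<close>

type_synonym 'a letter = "'a \<times> bool"

definition letter_inv :: "'a letter \<Rightarrow> 'a letter" where
  "letter_inv x = (fst x, \<not> snd x)"

definition reduced :: "'a letter list \<Rightarrow> bool" where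
  "reduced w \<longleftrightarrow> successively (\<lambda>x y. y \<noteq> letter_inv x) w"

fun push :: "'a letter \<Rightarrow> 'a letter list \<Rightarrow> 'a letter list" where
  "push x [] = [x]"
| "push x (y # w) = (if y = letter_inv x then w else x # y # w)"

text \<open>For reduced \<open>v\<close>, the word \<open>foldr push u v\<close> is the free reduction of the
  concatenation \<open>u @ v\<close>. The generators are all elements of the type \<open>'a\<close>.\<close>

definition free_group :: "'a letter list monoid" where
  "free_group = \<lparr>carrier = {w. reduced w}, monoid.mult = (\<lambda>u v. foldr push u v), one = []\<rparr>"

text \<open>The two elements of \<open>bool\<close> are the free generators of \<open>F\<^sub>2\<close>.\<close>

definition F2 :: "bool letter list monoid" where
  "F2 = free_group"

lemma letter_inv_inv [simp]: "letter_inv (letter_inv x) = x"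
  by (simp add: letter_inv_def)

lemma reduced_Nil [simp]: "reduced []"
  by (simp add: reduced_def)

lemma reduced_ConsD: "reduced (x # w) \<Longrightarrow> reduced w"
  by (auto simp: reduced_def successively_Cons)

lemma reduced_push: "reduced w \<Longrightarrow> reduced (push x w)"
  by (cases w) (auto simp: reduced_def successively_Cons)

lemma push_Cons_reduced: "reduced (x # w) \<Longrightarrow> push x w = x # w"
  by (cases w) (auto simp: reduced_def)

lemma push_push_inv: "reduced w \<Longrightarrow> push x (push (letter_inv x) w) = w"
  by (cases w) (auto simp: push_Cons_reduced)

lemma push_inv_push: "reduced w \<Longrightarrow> push (letter_inv x) (push x w) = w"
  using push_push_inv[of w "letter_inv x"] by simp

lemma reduced_foldr_push: "reduced v \<Longrightarrow> reduced (foldr push u v)"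
  by (induction u) (auto intro: reduced_push)

lemma foldr_push_push:
  assumes "reduced w"
  shows "foldr push (push x u) w = push x (foldr push u w)"
  using push_push_inv[OF reduced_foldr_push[OF assms]]
  by (cases u) auto

lemma foldr_push_assoc:
  "reduced w \<Longrightarrow> foldr push (foldr push u v) w = foldr push u (foldr push v w)"
  by (induction u) (auto simp: foldr_push_push)

lemma foldr_push_Nil: "reduced u \<Longrightarrow> foldr push u [] = u"
proof (induction u)
  case (Cons x u)
  then have "foldr push u [] = u" by (blast dest: reduced_ConsD)
  with Cons.prems show ?case by (simp add: push_Cons_reduced)
qed simp

lemma foldr_push_inverse:
  "reduced v \<Longrightarrow> foldr push (map letter_inv (rev u)) (foldr push u v) = v"
  by (induction u arbitrary: v) (auto simp: push_inv_push reduced_foldr_push)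

lemma group_free_group: "group (free_group :: 'a letter list monoid)"
proof (rule groupI)
  fix u :: "'a letter list" assume u: "u \<in> carrier free_group"
  let ?v = "foldr push (map letter_inv (rev u)) []"
  have "foldr push ?v u = foldr push (map letter_inv (rev u)) (foldr push u [])"
    using u by (simp add: free_group_def foldr_push_assoc foldr_push_Nil)
  then have "foldr push ?v u = []" by (simp add: foldr_push_inverse)
  then show "\<exists>v\<in>carrier free_group. v \<otimes>\<^bsub>free_group\<^esub> u = \<one>\<^bsub>free_group\<^esub>"
    by (intro bexI[of _ ?v]) (auto simp: free_group_def reduced_foldr_push)
qed (auto simp: free_group_def reduced_foldr_push foldr_push_assoc)

text \<open>The universal property, which characterises the free group on \<open>'a\<close>.\<close>

definition letter_val :: "('b, 'm) monoid_scheme \<Rightarrow> ('a \<Rightarrow> 'b) \<Rightarrow> 'a letter \<Rightarrow> 'b" where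
  "letter_val G f x = (if snd x then f (fst x) else inv\<^bsub>G\<^esub> f (fst x))"

lemma free_group_hom_exists:
  assumes "group G" and f: "\<And>a. f a \<in> carrier G"
  shows "\<exists>h \<in> hom free_group G. \<forall>a. h [(a, True)] = f a"
proof -
  interpret group G by fact
  define h where "h w = foldr (\<lambda>x y. letter_val G f x \<otimes>\<^bsub>G\<^esub> y) w \<one>\<^bsub>G\<^esub>" for w
  have val [simp]: "letter_val G f x \<in> carrier G" for x
    by (simp add: letter_val_def f)
  have val_inv: "letter_val G f (letter_inv x) = inv\<^bsub>G\<^esub> letter_val G f x" for x
    by (simp add: letter_val_def letter_inv_def f)
  have h_closed [simp]: "h w \<in> carrier G" for w
    unfolding h_def by (induction w) auto
  have h_Nil: "h [] = \<one>\<^bsub>G\<^esub>" and h_Cons: "h (x # w) = letter_val G f x \<otimes>\<^bsub>G\<^esub> h w" for x w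
    by (simp_all add: h_def)
  have h_push: "h (push x w) = letter_val G f x \<otimes>\<^bsub>G\<^esub> h w" for x w
    by (cases w) (auto simp: h_Nil h_Cons val_inv m_assoc[symmetric])
  have "h (foldr push u v) = h u \<otimes>\<^bsub>G\<^esub> h v" for u v
    by (induction u) (auto simp: h_Nil h_Cons h_push m_assoc)
  then have "h \<in> hom free_group G"
    by (auto simp: hom_def free_group_def)
  moreover have "h [(a, True)] = f a" for a
    by (simp add: h_def letter_val_def f)
  ultimately show ?thesis by blast
qed

lemma free_group_hom_unique:
  fixes h k :: "'a letter list \<Rightarrow> 'b" and G :: "('b, 'm) monoid_scheme"
  assumes "group G" and h: "h \<in> hom free_group G" and k: "k \<in> hom free_group G"
    and eq: "\<And>a. h [(a, True)] = k [(a, True)]" and w: "w \<in> carrier free_group"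
  shows "h w = k w"
proof -
  interpret G: group G by fact
  interpret F: group free_group by (rule group_free_group)
  interpret h: group_hom free_group G h by unfold_locales (rule h)
  interpret k: group_hom free_group G k by unfold_locales (rule k)
  have car: "[x] \<in> carrier free_group" for x :: "'a letter"
    by (simp add: free_group_def reduced_def)
  have "inv\<^bsub>free_group\<^esub> [(a, True)] = [(a, False)]" for a :: 'a
    by (rule F.inv_equality[OF _ car car]) (simp add: free_group_def letter_inv_def)
  then have eq': "h [(a, False)] = k [(a, False)]" for a
    using h.hom_inv[OF car[of "(a, True)"]] k.hom_inv[OF car[of "(a, True)"]] eq[of a] by simp
  have letter: "h [x] = k [x]" for x
    using eq[of "fst x"] eq'[of "fst x"] by (cases x; cases "snd x") auto
  show ?thesis
    using w
  proof (induction w)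
    case Nil
    then show ?case
      using h.hom_one k.hom_one by (simp add: free_group_def)
  next
    case (Cons x w)
    have w: "w \<in> carrier free_group"
      using Cons.prems by (auto simp: free_group_def dest: reduced_ConsD)
    have "x # w = [x] \<otimes>\<^bsub>free_group\<^esub> w"
      using Cons.prems by (simp add: free_group_def push_Cons_reduced)
    then show ?case
      using Cons.IH[OF w] letter[of x] h.hom_mult[OF car[of x] w] k.hom_mult[OF car[of x] w] by simp
  qed
qed

definition malnormal :: "'a set \<Rightarrow> ('a, 'm) monoid_scheme \<Rightarrow> bool" where
  "malnormal H G \<longleftrightarrow> subgroup H G \<and>
    (\<forall>g \<in> carrier G - H. H \<inter> (g <#\<^bsub>G\<^esub> H #>\<^bsub>G\<^esub> inv\<^bsub>G\<^esub> g) = {\<one>\<^bsub>G\<^esub>})"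

text \<open>For \<open>p > 0\<close> the condition on \<^const>\<open>card\<close> forces the index to be finite, since
  \<^const>\<open>card\<close> is \<open>0\<close> on infinite sets. Left and right cosets of \<open>N\<close> agree, as \<open>N\<close> is normal.\<close>

definition p_power_index_normal :: "nat \<Rightarrow> 'a set \<Rightarrow> ('a, 'm) monoid_scheme \<Rightarrow> bool" where
  "p_power_index_normal p N G \<longleftrightarrow> N \<lhd> G \<and> (\<exists>k. card (rcosets\<^bsub>G\<^esub> N) = p ^ k)"

definition pro_p_basic :: "nat \<Rightarrow> ('a, 'm) monoid_scheme \<Rightarrow> 'a set \<Rightarrow> bool" where
  "pro_p_basic p G U \<longleftrightarrow>
    (\<exists>N g. p_power_index_normal p N G \<and> g \<in> carrier G \<and> U = g <#\<^bsub>G\<^esub> N)"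

definition pro_p_topology :: "nat \<Rightarrow> ('a, 'm) monoid_scheme \<Rightarrow> 'a topology" where
  "pro_p_topology p G = topology (arbitrary union_of pro_p_basic p G)"

text \<open>For prime \<open>p\<close> the basic sets do form a base of a topology, so that
  \<^const>\<open>pro_p_topology\<close> is not an unspecified value of \<^const>\<open>topology\<close>.\<close>

lemma p_power_index_normal_Int:
  assumes "group G" "prime p" and M: "p_power_index_normal p M G" and N: "p_power_index_normal p N G"
  shows "p_power_index_normal p (M \<inter> N) G"
proof -
  interpret group G by fact
  obtain a b where nM: "M \<lhd> G" and nN: "N \<lhd> G"
    and a: "card (rcosets\<^bsub>G\<^esub> M) = p ^ a" and b: "card (rcosets\<^bsub>G\<^esub> N) = p ^ b"
    using M N by (auto simp: p_power_index_normal_def)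
  interpret M: normal M G by fact
  interpret N: normal N G by fact
  let ?Q = "(G Mod M) \<times>\<times> (G Mod N)"
  let ?h = "\<lambda>x. (M #>\<^bsub>G\<^esub> x, N #>\<^bsub>G\<^esub> x)"
  have Q: "group ?Q"
    by (intro DirProd_group M.factorgroup_is_group N.factorgroup_is_group)
  have hom: "?h \<in> hom G ?Q"
    by (simp add: hom_paired M.r_coset_hom_Mod N.r_coset_hom_Mod)
  interpret h: group_hom G ?Q ?h
    by (intro group_hom.intro group_hom_axioms.intro Q hom) (rule is_group)
  have ker: "kernel G ?Q ?h = M \<inter> N"
  proof -
    have "M #>\<^bsub>G\<^esub> x = M \<longleftrightarrow> x \<in> M" "N #>\<^bsub>G\<^esub> x = N \<longleftrightarrow> x \<in> N" if "x \<in> carrier G" for x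
      using that coset_join1[OF _ that M.subgroup_axioms] coset_join1[OF _ that N.subgroup_axioms]
        M.rcos_const N.rcos_const is_group by blast+
    then show ?thesis
      using M.subset N.subset by (auto simp: kernel_def FactGroup_def)
  qed
  have ordQ: "order ?Q = p ^ (a + b)"
    using a b by (simp add: order_def FactGroup_def card_cartesian_product power_add)
  have "card (?h ` carrier G) dvd order ?Q"
    by (subst group.lagrange[OF Q h.img_is_subgroup, symmetric]) (rule dvd_triv_right)
  moreover have "card (rcosets\<^bsub>G\<^esub> (M \<inter> N)) = card (?h ` carrier G)"
  proof -
    let ?I = "?Q\<lparr>carrier := ?h ` carrier G\<rparr>"
    have I: "group ?I"
      by (rule subgroup.subgroup_is_group[OF h.img_is_subgroup Q])
    have "?h \<in> hom G ?I"
      using hom by (auto simp: hom_def)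
    then have "group_hom G ?I ?h"
      by (intro group_hom.intro group_hom_axioms.intro I is_group)
    then have "G Mod kernel G ?I ?h \<cong> ?I"
      by (rule group_hom.FactGroup_iso) simp
    moreover have "kernel G ?I ?h = M \<inter> N"
      using ker by (simp add: kernel_def)
    ultimately have "G Mod (M \<inter> N) \<cong> ?I" by simp
    then show ?thesis
      by (auto simp: FactGroup_def dest: iso_same_card)
  qed
  ultimately have "card (rcosets\<^bsub>G\<^esub> (M \<inter> N)) dvd p ^ (a + b)"
    by (simp add: ordQ)
  then have "\<exists>k. card (rcosets\<^bsub>G\<^esub> (M \<inter> N)) = p ^ k"
    using divides_primepow_nat[OF \<open>prime p\<close>] by blast
  moreover have "M \<inter> N \<lhd> G"
    using h.normal_kernel by (simp add: ker)
  ultimately show ?thesis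
    by (simp add: p_power_index_normal_def)
qed

lemma pro_p_basic_Int:
  assumes "group G" "prime p" "pro_p_basic p G U" "pro_p_basic p G V" "x \<in> U" "x \<in> V"
  shows "pro_p_basic p G (U \<inter> V)"
proof -
  interpret group G by fact
  obtain M g N g' where M: "p_power_index_normal p M G" "g \<in> carrier G" "U = g <#\<^bsub>G\<^esub> M"
    and N: "p_power_index_normal p N G" "g' \<in> carrier G" "V = g' <#\<^bsub>G\<^esub> N"
    using assms by (auto simp: pro_p_basic_def)
  have sub: "subgroup M G" "subgroup N G"
    using M N by (auto simp: p_power_index_normal_def normal_def)
  have x: "x \<in> carrier G"
    using M assms(5) sub l_coset_subset_G subgroup.subset by blast
  have U: "U = x <#\<^bsub>G\<^esub> M" and V: "V = x <#\<^bsub>G\<^esub> N"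
    using l_repr_independence[OF _ _ sub(1)] l_repr_independence[OF _ _ sub(2)] M N assms(5,6)
    by blast+
  have "U \<inter> V = x <#\<^bsub>G\<^esub> (M \<inter> N)"
    using x subgroup.subset[OF sub(1)] subgroup.subset[OF sub(2)]
    by (auto simp: U V l_coset_def subset_iff)
  then show ?thesis
    using p_power_index_normal_Int[OF assms(1,2) M(1) N(1)] x by (auto simp: pro_p_basic_def)
qed

lemma openin_pro_p_topology:
  assumes "group G" "prime p"
  shows "openin (pro_p_topology p G) = arbitrary union_of pro_p_basic p G"
proof -
  have "(arbitrary union_of pro_p_basic p G) (U \<inter> V)"
    if "pro_p_basic p G U" "pro_p_basic p G V" for U V
  proof (cases "U \<inter> V = {}")
    case False
    then have "pro_p_basic p G (U \<inter> V)"
      using pro_p_basic_Int[OF assms that] by blast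
    then show ?thesis
      by (simp add: arbitrary_def union_of_inc)
  qed simp
  then have "istopology (arbitrary union_of pro_p_basic p G)"
    by (simp add: istopology_base_eq)
  then show ?thesis
    by (simp add: pro_p_topology_def)
qed

lemma topspace_pro_p_topology:
  assumes "group G" "prime p"
  shows "topspace (pro_p_topology p G) = carrier G"
proof -
  interpret group G by fact
  have "rcosets\<^bsub>G\<^esub> (carrier G) = {carrier G}"
    using coset_join2[OF _ subgroup_self] by (auto simp: RCOSETS_def)
  then have "card (rcosets\<^bsub>G\<^esub> (carrier G)) = p ^ 0" by simp
  moreover have "carrier G \<lhd> G"
    by (intro normalI subgroup_self) (simp add: coset_join2 coset_join3 subgroup_self)
  ultimately have "p_power_index_normal p (carrier G) G"
    unfolding p_power_index_normal_def by blast
  then have "pro_p_basic p G (carrier G)"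
    unfolding pro_p_basic_def by (metis coset_join3 one_closed subgroup_self)
  then have "openin (pro_p_topology p G) (carrier G)"
    by (simp add: openin_pro_p_topology assms arbitrary_def union_of_inc)
  moreover have "U \<subseteq> carrier G" if U: "pro_p_basic p G U" for U
  proof -
    obtain N g where "subgroup N G" "g \<in> carrier G" "U = g <#\<^bsub>G\<^esub> N"
      using U unfolding pro_p_basic_def p_power_index_normal_def
      by (blast dest: normal_imp_subgroup)
    then show ?thesis
      using l_coset_subset_G subgroup.subset by metis
  qed
  then have "U \<subseteq> carrier G" if "openin (pro_p_topology p G) U" for U
    using that by (auto simp: openin_pro_p_topology assms union_of_def)
  ultimately show ?thesis
    by (meson openin_subset openin_topspace subset_antisym)
qed

end

theory Submission
  imports Defs "HOL-Algebra.Group_Action" "HOL-Algebra.Generated_Groups" "HOL-Algebra.Zassenhaus"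
begin

text \<open>The witness is \<open>H = \<langle>ab, ba\<^sup>2\<rangle>\<close>. It maps onto the abelianization of \<open>F\<^sub>2\<close>, so by the
  Frattini argument it maps onto every finite \<open>p\<close>-quotient; hence it is dense in every
  pro-\<open>p\<close> topology, but it is proper. It is the group of loops at a vertex of a folded labelled
  graph, and it is malnormal because no nontrivial reduced word labels loops at two different
  vertices of that graph.\<close>


section \<open>Words, products and inverses in the free group\<close>

lemma (in group) inv_cancel:
  assumes "x \<in> carrier G" "y \<in> carrier G"
  shows "inv x \<otimes> (x \<otimes> y) = y" "x \<otimes> (inv x \<otimes> y) = y"
  using assms by (simp_all flip: m_assoc)

lemma reduced_append:
  "reduced (u @ v) \<longleftrightarrow> reduced u \<and> reduced v \<and> (u \<noteq> [] \<longrightarrow> v \<noteq> [] \<longrightarrow> hd v \<noteq> letter_inv (last u))"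
  by (auto simp: reduced_def successively_append_iff)

lemma foldr_push_reduced_append: "reduced (u @ v) \<Longrightarrow> foldr push u v = u @ v"
proof (induction u)
  case (Cons x u)
  then have "reduced (u @ v)"
    using reduced_ConsD by fastforce
  with Cons show ?case
    by (simp add: push_Cons_reduced)
qed simp

lemma reduced_inverse_word: "reduced u \<Longrightarrow> reduced (map letter_inv (rev u))"
  unfolding reduced_def successively_map successively_rev
  by (auto simp: letter_inv_def prod_eq_iff elim!: successively_mono)

lemma carrier_free_group: "w \<in> carrier free_group \<longleftrightarrow> reduced w"
  by (simp add: free_group_def)

lemma inv_free_group:
  assumes "reduced u"
  shows "inv\<^bsub>free_group\<^esub> u = map letter_inv (rev u)"
proof -
  interpret group free_group by (rule group_free_group)
  have "foldr push (map letter_inv (rev u)) u = []"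
    using foldr_push_inverse[of "[]" u] foldr_push_Nil[OF assms] by simp
  then show ?thesis
    using assms by (intro inv_equality) (auto simp: free_group_def reduced_inverse_word)
qed

section \<open>Folded labelled graphs and their groups of loops\<close>

locale inverse_automaton =
  fixes step :: "'v \<Rightarrow> 'a letter \<Rightarrow> 'v option"
  assumes step_inv: "step x l = Some y \<Longrightarrow> step y (letter_inv l) = Some x"
begin

fun run :: "'v \<Rightarrow> 'a letter list \<Rightarrow> 'v option" where
  "run x [] = Some x"
| "run x (l # w) = Option.bind (step x l) (\<lambda>y. run y w)"

lemma run_append: "run x (u @ v) = Option.bind (run x u) (\<lambda>y. run y v)"
  by (induction u arbitrary: x) (auto simp: bind_assoc split: Option.bind_split)

text \<open>By \<open>step_inv\<close>, reading a letter and then its inverse leads back to the same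
  vertex, so cancelling the pair keeps the end of the path. The converse fails: before reduction a
  word may leave the graph.\<close>

lemma run_push: "run x (l # w) = Some y \<Longrightarrow> run x (push l w) = Some y"
  by (cases w) (auto simp: bind_eq_Some_conv dest: step_inv)

lemma run_foldr_push: "run x u = Some y \<Longrightarrow> run y v = Some z \<Longrightarrow> run x (foldr push u v) = Some z"
proof (induction u arbitrary: x)
  case (Cons l u)
  then obtain x' where x': "step x l = Some x'" "run x' u = Some y"
    by (auto simp: bind_eq_Some_conv)
  then have "run x (l # foldr push u v) = Some z"
    using Cons by simp
  then show ?case
    using run_push by simp
qed simp

lemma run_mult: "run x u = Some y \<Longrightarrow> run y v = Some z \<Longrightarrow> run x (u \<otimes>\<^bsub>free_group\<^esub> v) = Some z"
  by (simp add: free_group_def run_foldr_push)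

lemma run_inverse_word: "run x u = Some y \<Longrightarrow> run y (map letter_inv (rev u)) = Some x"
  by (induction u arbitrary: x) (auto simp: run_append bind_eq_Some_conv step_inv)

lemma run_inv: "run x u = Some y \<Longrightarrow> reduced u \<Longrightarrow> run y (inv\<^bsub>free_group\<^esub> u) = Some x"
  by (simp add: inv_free_group run_inverse_word)

text \<open>This is the image of the fundamental group at \<open>x\<close> in the free group. As
  \<open>step\<close> is a function satisfying \<open>step_inv\<close>, the graph is folded in the
  sense of Stallings.\<close>

definition loops :: "'v \<Rightarrow> 'a letter list set" where
  "loops x = {w. reduced w \<and> run x w = Some x}"

lemma loops_carrier: "w \<in> loops x \<Longrightarrow> w \<in> carrier free_group"
  by (simp add: loops_def free_group_def)

lemma subgroup_loops: "subgroup (loops x) free_group"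
proof -
  interpret group free_group by (rule group_free_group)
  show ?thesis
  proof (rule subgroupI)
    have "[] \<in> loops x" by (simp add: loops_def)
    then show "loops x \<noteq> {}" by blast
    show "inv\<^bsub>free_group\<^esub> w \<in> loops x" if "w \<in> loops x" for w
      using that inv_closed[OF loops_carrier[OF that]]
      by (auto simp: loops_def run_inv carrier_free_group)
    show "v \<otimes>\<^bsub>free_group\<^esub> w \<in> loops x" if "v \<in> loops x" "w \<in> loops x" for v w
      using that m_closed[OF that[THEN loops_carrier]]
      by (auto simp: loops_def run_mult carrier_free_group)
  qed (auto simp: loops_carrier)
qed

text \<open>Change of base point: go along \<open>u\<close>, round the loop \<open>w\<close>, and
  back along \<open>u\<close>.\<close>

lemma conj_loops:
  assumes "w \<in> loops x" "reduced u" "run y u = Some x"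
  shows "u \<otimes>\<^bsub>free_group\<^esub> w \<otimes>\<^bsub>free_group\<^esub> inv\<^bsub>free_group\<^esub> u \<in> loops y"
proof -
  interpret group free_group by (rule group_free_group)
  have "u \<in> carrier free_group" using assms by (simp add: free_group_def)
  then have "u \<otimes>\<^bsub>free_group\<^esub> w \<otimes>\<^bsub>free_group\<^esub> inv\<^bsub>free_group\<^esub> u \<in> carrier free_group"
    using loops_carrier[OF assms(1)] by simp
  moreover have "run y (u \<otimes>\<^bsub>free_group\<^esub> w \<otimes>\<^bsub>free_group\<^esub> inv\<^bsub>free_group\<^esub> u) = Some y"
    using assms by (auto simp: loops_def intro!: run_mult run_inv)
  ultimately show ?thesis
    by (simp add: loops_def free_group_def)
qed

lemma longest_readable_prefix:
  obtains u v y where "w = u @ v" "run x u = Some y" "v = [] \<or> step y (hd v) = None"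
proof -
  have "\<exists>u v y. w = u @ v \<and> run x u = Some y \<and> (v = [] \<or> step y (hd v) = None)"
  proof (induction w arbitrary: x)
    case (Cons l w)
    show ?case
    proof (cases "step x l")
      case None
      then show ?thesis
        by (intro exI[of _ "[]"] exI[of _ "l # w"] exI[of _ x]) simp
    next
      case (Some x')
      from Cons[of x'] obtain u v y
        where "w = u @ v" "run x' u = Some y" "v = [] \<or> step y (hd v) = None" by blast
      with Some show ?thesis
        by (intro exI[of _ "l # u"] exI[of _ v] exI[of _ y]) simp
    qed
  qed simp
  then show ?thesis using that by blast
qed

text \<open>Apply the prefix version to the inverse word, read from \<open>x\<close>, and invert the
  result.\<close>

lemma longest_readable_suffix:
  obtains u v y where "w = u @ v" "run y v = Some x"
    "u = [] \<or> step y (letter_inv (last u)) = None"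
proof -
  obtain u v y where *: "map letter_inv (rev w) = u @ v" "run x u = Some y"
    "v = [] \<or> step y (hd v) = None"
    using longest_readable_prefix by blast
  have "w = map letter_inv (rev (map letter_inv (rev w)))"
    by (simp add: rev_map comp_def)
  also have "\<dots> = map letter_inv (rev v) @ map letter_inv (rev u)"
    by (simp add: *)
  finally have "w = map letter_inv (rev v) @ map letter_inv (rev u)" .
  moreover have "map letter_inv (rev v) = []
      \<or> step y (letter_inv (last (map letter_inv (rev v)))) = None"
    using *(3) by (cases "v = []") (simp_all add: last_map last_rev)
  ultimately show ?thesis
    using that run_inverse_word[OF *(2)] by blast
qed

text \<open>This excludes cancellation next to a loop: a letter that is unreadable at
  \<open>x\<close> can neither start a loop at \<open>x\<close> nor be the inverse of its last
  letter.\<close>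

lemma loops_readable:
  assumes "w \<in> loops x" "w \<noteq> []"
  shows "step x (hd w) \<noteq> None" "step x (letter_inv (last w)) \<noteq> None"
proof -
  have first: "step x (hd v) \<noteq> None" if "run x v = Some y" "v \<noteq> []" for v y
    using that by (cases v) (auto simp: bind_eq_Some_conv)
  have run: "run x w = Some x" using assms by (simp add: loops_def)
  show "step x (hd w) \<noteq> None"
    using first[OF run assms(2)] .
  show "step x (letter_inv (last w)) \<noteq> None"
    using first[OF run_inverse_word[OF run]] assms(2) by (simp add: hd_map hd_rev)
qed

text \<open>A maximal non-readable middle part \<open>m\<close> of the conjugator cannot cancel against loops,
  so \<open>h m = m k\<close> is an equation between words, and its two sides start differently.\<close>

lemma no_conjugate_loops:
  assumes "h \<in> loops x" "k \<in> loops y" "reduced m" "m \<noteq> []"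
    and "step x (hd m) = None" "step y (letter_inv (last m)) = None"
    and eq: "h \<otimes>\<^bsub>free_group\<^esub> m = m \<otimes>\<^bsub>free_group\<^esub> k"
  shows "h = []"
proof (rule ccontr)
  assume h: "h \<noteq> []"
  have "reduced (h @ m)" "reduced (m @ k)"
    using assms loops_readable[of h x] loops_readable[of k y]
    by (auto simp: reduced_append loops_def)
  then have "h @ m = m @ k"
    using eq by (simp add: free_group_def foldr_push_reduced_append)
  then have "hd h = hd m"
    using h \<open>m \<noteq> []\<close> by (metis hd_append2)
  then show False
    using loops_readable(1)[OF assms(1) h] assms by simp
qed

text \<open>Split a conjugator as \<open>g1 @ m @ g3\<close>, where \<open>g1\<close> is the longest
  prefix readable from \<open>x0\<close> and \<open>g3\<close> the longest remaining suffix readable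
  into \<open>x0\<close>. Moving base points along \<open>g1\<close> and \<open>g3\<close> leaves
  loops \<open>h'\<close> and \<open>k'\<close> conjugated by \<open>m\<close> alone. If
  \<open>m\<close> is empty they are one word looping at two vertices, which \<open>sep\<close>
  makes trivial; otherwise \<open>no_conjugate_loops\<close> applies.\<close>

lemma malnormal_loops:
  assumes sep: "\<And>w x y. w \<in> loops x \<Longrightarrow> w \<in> loops y \<Longrightarrow> x \<noteq> y \<Longrightarrow> w = []"
  shows "malnormal (loops x0) free_group"
proof -
  interpret group free_group by (rule group_free_group)
  interpret L: subgroup "loops x0" free_group by (rule subgroup_loops)
  have one: "\<one>\<^bsub>free_group\<^esub> = []" by (simp add: free_group_def)
  have main: "g \<otimes>\<^bsub>free_group\<^esub> k \<otimes>\<^bsub>free_group\<^esub> inv\<^bsub>free_group\<^esub> g = \<one>\<^bsub>free_group\<^esub>"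
    if g: "g \<in> carrier free_group" "g \<notin> loops x0" and k: "k \<in> loops x0"
      and h: "g \<otimes>\<^bsub>free_group\<^esub> k \<otimes>\<^bsub>free_group\<^esub> inv\<^bsub>free_group\<^esub> g \<in> loops x0"
    for g k
  proof -
    define h where "h = g \<otimes>\<^bsub>free_group\<^esub> k \<otimes>\<^bsub>free_group\<^esub> inv\<^bsub>free_group\<^esub> g"
    have h: "h \<in> loops x0" using h by (simp add: h_def)
    obtain g1 g2 x where g12: "g = g1 @ g2" "run x0 g1 = Some x" "g2 = [] \<or> step x (hd g2) = None"
      using longest_readable_prefix by blast
    obtain m g3 z where g23: "g2 = m @ g3" "run z g3 = Some x0"
      "m = [] \<or> step z (letter_inv (last m)) = None"
      using longest_readable_suffix by blast
    have red: "reduced g" using g by (simp add: free_group_def)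
    then have reds: "reduced g1" "reduced m" "reduced g3" "reduced (m @ g3)"
      by (auto simp: g12 g23 reduced_append)
    then have car: "g1 \<in> carrier free_group" "m \<in> carrier free_group" "g3 \<in> carrier free_group"
      by (auto simp: free_group_def)
    have kc: "k \<in> carrier free_group" using k loops_carrier by blast
    have g_eq: "g = g1 \<otimes>\<^bsub>free_group\<^esub> (m \<otimes>\<^bsub>free_group\<^esub> g3)"
      using red reds by (simp add: free_group_def foldr_push_reduced_append g12 g23)
    define h' where "h' = inv\<^bsub>free_group\<^esub> g1 \<otimes>\<^bsub>free_group\<^esub> h \<otimes>\<^bsub>free_group\<^esub> g1"
    define k' where "k' = g3 \<otimes>\<^bsub>free_group\<^esub> k \<otimes>\<^bsub>free_group\<^esub> inv\<^bsub>free_group\<^esub> g3"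
    have h': "h' \<in> loops x"
      using conj_loops[OF h, of "inv\<^bsub>free_group\<^esub> g1" x] car run_inv[OF g12(2)] reds
        inv_closed[OF car(1)]
      by (simp add: h'_def carrier_free_group)
    have k': "k' \<in> loops z"
      unfolding k'_def using conj_loops[OF k] reds g23 by blast
    have cars: "h' \<in> carrier free_group" "k' \<in> carrier free_group"
      using h' k' loops_carrier by blast+
    have h_eq: "h = g1 \<otimes>\<^bsub>free_group\<^esub> h' \<otimes>\<^bsub>free_group\<^esub> inv\<^bsub>free_group\<^esub> g1"
      using car loops_carrier[OF h] by (simp add: h'_def m_assoc inv_cancel)
    have eq: "h' \<otimes>\<^bsub>free_group\<^esub> m = m \<otimes>\<^bsub>free_group\<^esub> k'"
      using car kc
      by (simp add: h'_def k'_def h_def g_eq m_assoc inv_mult_group inv_cancel)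
    have "h' = []"
    proof (cases "m = []")
      case True
      then have "h' = k'"
        using eq cars one by (metis l_one r_one)
      \<comment> \<open>Were the vertices equal, an empty \<open>g3\<close> would make
        \<open>g\<close> a loop at \<open>x0\<close>, and a nonempty \<open>g3\<close> would extend
        the maximal prefix \<open>g1\<close>.\<close>
      moreover have "x \<noteq> z"
      proof
        assume "x = z"
        show False
        proof (cases "g3 = []")
          case True
          then show False
            using g g12 g23 \<open>m = []\<close> \<open>x = z\<close> by (auto simp: loops_def free_group_def)
        next
          case False
          then show False
            using g12(3) g23 \<open>m = []\<close> \<open>x = z\<close> by (cases g3) auto
        qed
      qed
      ultimately show ?thesis
        using sep h' k' by blast
    next
      case False
      then show ?thesis
        using no_conjugate_loops[OF h' k' _ False _ _ eq] g12(3) g23 reds by simp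
    qed
    then have "h = \<one>\<^bsub>free_group\<^esub>"
      using car by (simp add: h_eq one[symmetric])
    then show ?thesis by (simp add: h_def)
  qed
  show ?thesis
    unfolding malnormal_def
  proof (intro conjI ballI subgroup_loops)
    fix g assume g: "g \<in> carrier free_group - loops x0"
    let ?C = "g <#\<^bsub>free_group\<^esub> loops x0 #>\<^bsub>free_group\<^esub> inv\<^bsub>free_group\<^esub> g"
    have C: "?C = (\<lambda>k. g \<otimes>\<^bsub>free_group\<^esub> k \<otimes>\<^bsub>free_group\<^esub> inv\<^bsub>free_group\<^esub> g) ` loops x0"
      by (auto simp: l_coset_def r_coset_def)
    have "g \<otimes>\<^bsub>free_group\<^esub> \<one>\<^bsub>free_group\<^esub> \<otimes>\<^bsub>free_group\<^esub> inv\<^bsub>free_group\<^esub> g \<in> ?C"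
      unfolding C using L.one_closed by (rule imageI)
    then have "\<one>\<^bsub>free_group\<^esub> \<in> ?C"
      using g by simp
    moreover have "h = \<one>\<^bsub>free_group\<^esub>" if "h \<in> loops x0" "h \<in> ?C" for h
      using main[of g] g that unfolding C by blast
    ultimately show "loops x0 \<inter> ?C = {\<one>\<^bsub>free_group\<^esub>}"
      using L.one_closed by blast
  qed
qed

text \<open>Pairs of distinct states are read along paths without branching, and the rank
  strictly decreases along them.\<close>

lemma no_common_loop:
  fixes r :: "'v \<Rightarrow> 'v \<Rightarrow> nat"
  assumes unbranched: "\<And>x y l l'. x \<noteq> y \<Longrightarrow> step x l \<noteq> None \<Longrightarrow> step y l \<noteq> None \<Longrightarrow>
      step x l' \<noteq> None \<Longrightarrow> step y l' \<noteq> None \<Longrightarrow> snd l = snd l' \<Longrightarrow> l = l'"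
    and rank: "\<And>x y x' y' a. x \<noteq> y \<Longrightarrow> step x (a, True) = Some x' \<Longrightarrow>
      step y (a, True) = Some y' \<Longrightarrow> r x' y' < r x y"
    and w: "w \<in> loops x" "w \<in> loops y" and "x \<noteq> y"
  shows "w = []"
proof -
  \<comment> \<open>A reduced word readable from both vertices has letters of only one sign, so the
    rank is strictly monotone along it. A nonempty common loop would then give
    \<open>r x y < r x y\<close>.\<close>
  have "if snd l then r x' y' < r x y else r x y < r x' y'"
    if "reduced (l # w)" "run x (l # w) = Some x'" "run y (l # w) = Some y'" "x \<noteq> y"
    for l w x y x' y'
    using that
  proof (induction w arbitrary: l x y)
    case Nil
    then have s: "step x l = Some x'" "step y l = Some y'"
      by (auto simp: bind_eq_Some_conv)
    then have "x' \<noteq> y'"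
      using Nil(4) s[THEN step_inv] by auto
    then show ?case
      using rank[OF Nil(4)] rank[of x' y'] s s[THEN step_inv]
      by (cases l) (auto simp: letter_inv_def)
  next
    case (Cons l' w)
    then obtain x1 y1 where s: "step x l = Some x1" "step y l = Some y1"
      and run: "run x1 (l' # w) = Some x'" "run y1 (l' # w) = Some y'"
      by (auto simp: bind_eq_Some_conv)
    have ne: "x1 \<noteq> y1"
      using Cons.prems(4) s[THEN step_inv] by auto
    have red: "reduced (l' # w)" "l' \<noteq> letter_inv l"
      using Cons.prems(1) by (auto simp: reduced_def)
    \<comment> \<open>At a change of sign, \<open>l'\<close> and the inverse of \<open>l\<close>
      would have the same sign and both be readable at \<open>x1\<close> and \<open>y1\<close>.
      Unbranchedness would identify them, against reducedness.\<close>
    have "snd l' = snd l"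
    proof (rule ccontr)
      assume "snd l' \<noteq> snd l"
      then have "letter_inv l = l'"
        using run s[THEN step_inv]
        by (intro unbranched[OF ne]) (auto simp: letter_inv_def bind_eq_Some_conv)
      then show False using red by simp
    qed
    \<comment> \<open>For a negative letter the rank hypothesis is applied to the reversed edges,
      from \<open>x1\<close>, \<open>y1\<close> to \<open>x\<close>, \<open>y\<close>.\<close>
    moreover have "if snd l then r x1 y1 < r x y else r x y < r x1 y1"
      using rank[OF Cons.prems(4)] rank[OF ne] s s[THEN step_inv]
      by (cases l) (auto simp: letter_inv_def)
    ultimately show ?case
      using Cons.IH[OF red(1) run ne] by (auto split: if_splits)
  qed
  from this[of "hd w" "tl w" x x y y] w \<open>x \<noteq> y\<close> show ?thesis
    by (cases w) (auto simp: loops_def split: if_splits)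
qed

end

section \<open>Centers of p-groups, the Frattini argument and density\<close>

definition (in group) center :: "'a set" where
  "center = {z \<in> carrier G. \<forall>x \<in> carrier G. z \<otimes> x = x \<otimes> z}"

lemma (in group) normal_center: "center \<lhd> G"
proof (rule normalI)
  show "subgroup center G"
  proof (rule subgroupI)
    show "inv z \<in> center" if "z \<in> center" for z
    proof -
      have "inv z \<otimes> x = x \<otimes> inv z" if x: "x \<in> carrier G" for x
      proof -
        have "z \<otimes> x = x \<otimes> z" "z \<in> carrier G" using \<open>z \<in> center\<close> x by (auto simp: center_def)
        then show ?thesis
          using x by (metis inv_closed inv_solve_left inv_solve_right m_assoc m_closed)
      qed
      then show ?thesis using that by (auto simp: center_def)
    qed
    show "y \<otimes> z \<in> center" if "y \<in> center" "z \<in> center" for y z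
    proof -
      have yz: "y \<in> carrier G" "z \<in> carrier G" using that by (auto simp: center_def)
      have "y \<otimes> z \<otimes> x = x \<otimes> (y \<otimes> z)" if x: "x \<in> carrier G" for x
      proof -
        have c: "z \<otimes> x = x \<otimes> z" "y \<otimes> x = x \<otimes> y"
          using \<open>y \<in> center\<close> \<open>z \<in> center\<close> x unfolding center_def by blast+
        have "y \<otimes> z \<otimes> x = y \<otimes> x \<otimes> z" using c(1) yz x by (simp add: m_assoc)
        then show ?thesis using c(2) yz x by (simp add: m_assoc)
      qed
      then show ?thesis using yz by (simp add: center_def)
    qed
    have "\<one> \<in> center" by (simp add: center_def)
    then show "center \<noteq> {}" by blast
  qed (auto simp: center_def)
qed (auto simp: center_def r_coset_def l_coset_def)

text \<open>The class equation: conjugacy classes have p-power size, and with a trivial center only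
  the class of the identity is a singleton. The order would then be 1 modulo
  \<open>p\<close>.\<close>

lemma (in group) p_group_center_nontrivial:
  assumes "prime p" "order G = p ^ Suc k"
  shows "center \<noteq> {\<one>}"
proof
  assume triv: "center = {\<one>}"
  let ?\<phi> = "\<lambda>g. \<lambda>h \<in> carrier G. g \<otimes> h \<otimes> inv g"
  interpret act: group_action G "carrier G" ?\<phi> by (rule action_by_conjugation)
  have fin: "finite (carrier G)"
    using assms order_gt_0_iff_finite by (simp add: prime_gt_0_nat)
  have orb1: "orbit G ?\<phi> \<one> = {\<one>}"
    using act.orbit_refl[of \<one>] by (auto simp: orbit_def)
  have dvd: "p dvd card C" if C: "C \<in> orbits G (carrier G) ?\<phi> - {{\<one>}}" for C
  proof -
    obtain x where x: "x \<in> carrier G" "C = orbit G ?\<phi> x"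
      using C by (auto simp: orbits_def)
    have "card C dvd p ^ Suc k"
      unfolding x(2) assms(2)[symmetric] act.orbit_stabilizer_theorem[OF x(1), symmetric]
      by (rule dvd_triv_left)
    then obtain i where i: "card C = p ^ i"
      using divides_primepow_nat[OF assms(1)] by blast
    \<comment> \<open>A singleton class consists of a central element, hence of the identity, but
      that class was removed.\<close>
    have "i \<noteq> 0"
    proof
      assume "i = 0"
      then obtain y where "C = {y}" using i by (auto simp: card_1_singleton_iff)
      then have Cx: "C = {x}"
        using act.orbit_refl[OF x(1)] x(2) by auto
      have "x \<otimes> g = g \<otimes> x" if g: "g \<in> carrier G" for g
      proof -
        have "g \<otimes> x \<otimes> inv g \<in> C"
          using x g unfolding orbit_def by force
        then have "g \<otimes> x \<otimes> inv g = x" using Cx by simp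
        then show ?thesis using x g by (metis inv_solve_right m_closed)
      qed
      then have "x \<in> center" using x unfolding center_def by blast
      then show False using triv Cx C by auto
    qed
    then show ?thesis using i by simp
  qed
  have mem: "{\<one>} \<in> orbits G (carrier G) ?\<phi>"
    using orb1 by (auto simp: orbits_def)
  have finO: "finite (orbits G (carrier G) ?\<phi>)"
    using fin by (auto simp: orbits_def)
  have "p ^ Suc k = (\<Sum>C \<in> orbits G (carrier G) ?\<phi>. card C)"
    using act.disjoint_sum[OF fin, of "\<lambda>_. 1 :: nat"] assms(2) by (simp add: order_def)
  also have "\<dots> = 1 + (\<Sum>C \<in> orbits G (carrier G) ?\<phi> - {{\<one>}}. card C)"
    using sum.remove[OF finO mem, of card] by simp
  finally have "p ^ Suc k = 1 + (\<Sum>C \<in> orbits G (carrier G) ?\<phi> - {{\<one>}}. card C)" .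
  moreover have "p dvd (\<Sum>C \<in> orbits G (carrier G) ?\<phi> - {{\<one>}}. card C)"
    using dvd by (rule dvd_sum)
  moreover have "p dvd p ^ Suc k" by simp
  ultimately have "p dvd 1"
    by (simp only: dvd_add_left_iff)
  then show False using assms(1) by simp
qed

text \<open>Take for \<open>M\<close> the preimage of the center of G/N, as the kernel of the
  composite map to (G/N)/Z. Nontriviality of the center makes the index drop, and centrality of M/N
  puts the commutators into \<open>N\<close>.\<close>

lemma (in group) larger_p_power_index_normal:
  assumes "prime p" "N \<lhd> G" "card (rcosets N) = p ^ Suc k"
  obtains M j where "M \<lhd> G" "card (rcosets M) = p ^ j" "j \<le> k" "N \<subseteq> M"
    "\<And>x m. x \<in> carrier G \<Longrightarrow> m \<in> M \<Longrightarrow> x \<otimes> m \<otimes> inv x \<otimes> inv m \<in> N"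
proof -
  interpret N: normal N G by fact
  let ?Q = "G Mod N"
  interpret Q: group ?Q by (rule N.factorgroup_is_group)
  define Z where "Z = Q.center"
  interpret Z: normal Z ?Q unfolding Z_def by (rule Q.normal_center)
  let ?R = "?Q Mod Z"
  interpret R: group ?R by (rule Z.factorgroup_is_group)
  let ?h = "\<lambda>x. Z #>\<^bsub>?Q\<^esub> (N #> x)"
  have ordQ: "order ?Q = p ^ Suc k"
    using assms by (simp add: order_def FactGroup_def)
  have "?h = (\<lambda>a. Z #>\<^bsub>?Q\<^esub> a) \<circ> (\<lambda>x. N #> x)" by auto
  then have hom: "?h \<in> hom G ?R"
    using Group.hom_compose[OF N.r_coset_hom_Mod Z.r_coset_hom_Mod] by simp
  interpret h: group_hom G ?R ?h
    by (intro group_hom.intro group_hom_axioms.intro hom R.is_group is_group)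
  define M where "M = kernel G ?R ?h"
  have Mmem: "m \<in> M \<longleftrightarrow> m \<in> carrier G \<and> N #> m \<in> Z" for m
  proof -
    have "?h m = Z \<longleftrightarrow> N #> m \<in> Z" if "m \<in> carrier G"
    proof -
      have "N #> m \<in> carrier ?Q" using that by (auto simp: FactGroup_def RCOSETS_def)
      then show ?thesis
        using Q.coset_join1[OF _ _ Z.subgroup_axioms] Z.rcos_const[OF Q.is_group] Z.subset by blast
    qed
    then show ?thesis by (auto simp: M_def kernel_def FactGroup_def)
  qed
  have cardM: "card (rcosets M) * card Z = p ^ Suc k"
  proof -
    have "?h ` carrier G = carrier ?R"
      by (auto simp: FactGroup_def RCOSETS_def)
    then have "G Mod M \<cong> ?R" unfolding M_def by (rule h.FactGroup_iso)
    then have "card (rcosets M) = card (rcosets\<^bsub>?Q\<^esub> Z)"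
      by (auto simp: FactGroup_def dest: iso_same_card)
    then show ?thesis
      using Q.lagrange[OF Z.subgroup_axioms] ordQ by simp
  qed
  then obtain j where j: "card (rcosets M) = p ^ j"
    using divides_primepow_nat[OF assms(1)] by (metis dvd_triv_left)
  have "card Z \<noteq> 1"
  proof
    assume "card Z = 1"
    then have "Z = {\<one>\<^bsub>?Q\<^esub>}" using Z.one_closed by (auto simp: card_1_singleton_iff)
    then show False using Q.p_group_center_nontrivial[OF assms(1) ordQ] by (simp add: Z_def)
  qed
  then have "j \<noteq> Suc k" using cardM j assms(1) by auto
  moreover have "p ^ j dvd p ^ Suc k" using cardM j by (metis dvd_triv_left)
  then have "j \<le> Suc k" using assms(1) by (metis power_dvd_imp_le prime_gt_1_nat)
  ultimately have "j \<le> k" by simp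
  moreover have "N \<subseteq> M"
  proof
    fix n assume n: "n \<in> N"
    then have "N #> n = N" using N.rcos_const is_group by blast
    then show "n \<in> M" using Mmem n Z.one_closed by (auto simp: FactGroup_def)
  qed
  moreover have "x \<otimes> m \<otimes> inv x \<otimes> inv m \<in> N" if x: "x \<in> carrier G" and m: "m \<in> M" for x m
  proof -
    have mc: "m \<in> carrier G" "N #> m \<in> Z" using m Mmem by auto
    have "N #> x \<in> carrier ?Q" using x by (auto simp: FactGroup_def RCOSETS_def)
    then have "(N #> m) \<otimes>\<^bsub>?Q\<^esub> (N #> x) = (N #> x) \<otimes>\<^bsub>?Q\<^esub> (N #> m)"
      using mc(2) unfolding Z_def Q.center_def by blast
    then have "(N #> m) <#> (N #> x) = (N #> x) <#> (N #> m)"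
      by (simp add: FactGroup_def)
    then have "N #> (x \<otimes> m) = N #> (m \<otimes> x)"
      using N.rcos_sum x mc by simp
    then have "x \<otimes> m \<in> N #> (m \<otimes> x)"
      using rcos_self[OF _ N.subgroup_axioms, of "x \<otimes> m"] x mc by simp
    then have "x \<otimes> m \<otimes> inv (m \<otimes> x) \<in> N"
      using N.rcos_module_imp[OF is_group] x mc by blast
    then show ?thesis using x mc by (simp add: inv_mult_group m_assoc)
  qed
  ultimately show ?thesis
    using that[of M j] j h.normal_kernel by (simp add: M_def)
qed

text \<open>The Frattini argument for the \<open>p\<close>-group \<open>G / N\<close>, by induction on its order: if \<open>H M = G\<close>
  for the preimage \<open>M\<close> of the center, then commutators modulo \<open>N\<close> are commutators of elements
  of \<open>H\<close>.\<close>

lemma (in group) set_mult_p_power_index_normal: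
  assumes "prime p" "subgroup H G"
    and top: "\<And>L. subgroup L G \<Longrightarrow> H \<subseteq> L \<Longrightarrow> derived G (carrier G) \<subseteq> L \<Longrightarrow> L = carrier G"
    and "N \<lhd> G" "card (rcosets N) = p ^ k"
  shows "H <#> N = carrier G"
  using assms(4,5)
proof (induction k arbitrary: N rule: less_induct)
  case (less k)
  interpret H: subgroup H G by fact
  interpret N: normal N G by fact
  have sub: "subgroup (H <#> N) G"
    using commut_normal[OF assms(2) less(2)] mult_norm_subgroup[OF less(2) assms(2)] by simp
  interpret HN: subgroup "H <#> N" G by (rule sub)
  have H_le: "H \<subseteq> H <#> N"
  proof
    fix h assume "h \<in> H"
    then have "h \<otimes> \<one> \<in> H <#> N" using N.one_closed unfolding set_mult_def by blast
    then show "h \<in> H <#> N" using \<open>h \<in> H\<close> by simp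
  qed
  have N_le: "N \<subseteq> H <#> N"
  proof
    fix n assume "n \<in> N"
    then have "\<one> \<otimes> n \<in> H <#> N" using H.one_closed unfolding set_mult_def by blast
    then show "n \<in> H <#> N" using \<open>n \<in> N\<close> by simp
  qed
  show ?case
  proof (cases k)
    case 0
    then have "card (rcosets N) = 1" using less(3) by simp
    then obtain C where C: "rcosets N = {C}" by (auto simp: card_1_singleton_iff)
    have "x \<in> N" if x: "x \<in> carrier G" for x
    proof -
      have "N #> x \<in> rcosets N" "N #> \<one> \<in> rcosets N" using x by (auto simp: RCOSETS_def)
      then have "N #> x = N" using C N.subset by simp
      then show ?thesis using rcos_self[OF x N.subgroup_axioms] by simp
    qed
    then show ?thesis using N_le HN.subset by blast
  next
    case (Suc k')
    obtain M j where M: "M \<lhd> G" "card (rcosets M) = p ^ j" "j \<le> k'" "N \<subseteq> M"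
      "\<And>x m. x \<in> carrier G \<Longrightarrow> m \<in> M \<Longrightarrow> x \<otimes> m \<otimes> inv x \<otimes> inv m \<in> N"
      using larger_p_power_index_normal[OF assms(1) less(2)] less(3) Suc by blast
    have HM: "H <#> M = carrier G"
      using less.IH[of j M] M Suc by simp
    interpret M: normal M G by fact
    have "x \<otimes> y \<otimes> inv x \<otimes> inv y \<in> H <#> N" if xy: "x \<in> carrier G" "y \<in> carrier G" for x y
    proof -
      have "x \<in> H <#> M" "y \<in> H <#> M" using xy HM by simp_all
      then obtain h m h' m'
        where d: "h \<in> H" "m \<in> M" "x = h \<otimes> m" "h' \<in> H" "m' \<in> M" "y = h' \<otimes> m'"
        unfolding set_mult_def by blast
      \<comment> \<open>Elements of \<open>M\<close> are central modulo \<open>N\<close>;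
        \<open>swap\<close> uses this inside a longer product.\<close>
      have comm: "N #> (z \<otimes> w) = N #> (w \<otimes> z)" if "z \<in> carrier G" "w \<in> M" for z w
      proof -
        have "z \<otimes> w \<otimes> inv (w \<otimes> z) \<in> N"
          using M(5)[OF that] that by (simp add: inv_mult_group m_assoc)
        then have "z \<otimes> w \<in> N #> (w \<otimes> z)"
          using that by (intro N.rcos_module_rev[OF is_group]) auto
        then show ?thesis
          using repr_independence[OF _ _ N.subgroup_axioms] that by (metis M.mem_carrier m_closed)
      qed
      have swap: "N #> (u \<otimes> z \<otimes> w \<otimes> v) = N #> (u \<otimes> w \<otimes> z \<otimes> v)"
        if "u \<in> carrier G" "v \<in> carrier G" "z \<in> carrier G" "w \<in> M" for u v z w
      proof -
        have "N #> (u \<otimes> (z \<otimes> w) \<otimes> v) = (N #> u) <#> (N #> (z \<otimes> w)) <#> (N #> v)"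
          using that by (simp add: N.rcos_sum)
        also have "\<dots> = N #> (u \<otimes> (w \<otimes> z) \<otimes> v)"
          using that comm by (simp add: N.rcos_sum)
        finally show ?thesis using that by (simp add: m_assoc)
      qed
      define c where "c = h \<otimes> h' \<otimes> inv h \<otimes> inv h'"
      have c: "c \<in> H" using d by (simp add: c_def)
      have cars: "h \<in> carrier G" "h' \<in> carrier G" "m \<in> carrier G" "m' \<in> carrier G"
        using d by auto
      \<comment> \<open>Modulo \<open>N\<close>, xy = h m h' m' = h h' m m' = c h' h m m' = c h' m'
        h m = c y x. The factors from \<open>M\<close> move freely, so only the commutator
        \<open>c\<close> of the parts in \<open>H\<close> remains.\<close>
      have "N #> (x \<otimes> y) = N #> (\<one> \<otimes> (h \<otimes> h') \<otimes> m \<otimes> m')"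
        using swap[of h m' h' m] cars d by (simp add: m_assoc)
      also have "\<dots> = N #> (c \<otimes> (h' \<otimes> h \<otimes> m \<otimes> m'))"
        using cars by (simp add: c_def m_assoc inv_cancel)
      also have "\<dots> = (N #> c) <#> (N #> (h' \<otimes> h \<otimes> m \<otimes> m'))"
        using cars c by (simp add: N.rcos_sum)
      also have "N #> (h' \<otimes> h \<otimes> m \<otimes> m') = N #> (h' \<otimes> m' \<otimes> (h \<otimes> m) \<otimes> \<one>)"
        using swap[of h' \<one> "h \<otimes> m" m'] cars d by (simp add: m_assoc)
      also have "(N #> c) <#> \<dots> = N #> (c \<otimes> (y \<otimes> x))"
        using cars c d by (simp add: N.rcos_sum)
      finally have "x \<otimes> y \<in> N #> (c \<otimes> (y \<otimes> x))"
        using rcos_self[OF _ N.subgroup_axioms, of "x \<otimes> y"] xy by simp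
      then have "x \<otimes> y \<otimes> inv (c \<otimes> (y \<otimes> x)) \<in> N"
        using N.rcos_module_imp[OF is_group] xy c by simp
      \<comment> \<open>The right factor \<open>c\<close> cancels the inverse of \<open>c\<close>,
        which leaves the commutator of \<open>x\<close> and \<open>y\<close>.\<close>
      then have "x \<otimes> y \<otimes> inv (c \<otimes> (y \<otimes> x)) \<otimes> c \<in> H <#> N"
        using N_le H_le c by blast
      moreover have "x \<otimes> y \<otimes> inv (c \<otimes> (y \<otimes> x)) \<otimes> c = x \<otimes> y \<otimes> inv x \<otimes> inv y"
        using xy c by (simp add: inv_mult_group m_assoc)
      ultimately show ?thesis by simp
    qed
    then have "derived_set G (carrier G) \<subseteq> H <#> N" by blast
    then have "derived G (carrier G) \<subseteq> H <#> N"
      unfolding derived_def using generate_subgroup_incl[OF _ sub] by blast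
    then show ?thesis using top[OF sub H_le] by blast
  qed
qed

text \<open>The hypothesis \<open>top\<close> says that \<open>H\<close> maps onto the
  abelianization of the group. By the Frattini argument \<open>H\<close> then meets every coset of
  every normal subgroup of p-power index, so its nonempty complement contains no basic open
  set.\<close>

lemma (in group) not_closedin_pro_p:
  assumes "prime p" "subgroup H G" "H \<noteq> carrier G"
    and top: "\<And>L. subgroup L G \<Longrightarrow> H \<subseteq> L \<Longrightarrow> derived G (carrier G) \<subseteq> L \<Longrightarrow> L = carrier G"
  shows "\<not> closedin (pro_p_topology p G) H"
proof
  interpret H: subgroup H G by fact
  assume "closedin (pro_p_topology p G) H"
  then have "openin (pro_p_topology p G) (carrier G - H)"
    by (simp add: closedin_def topspace_pro_p_topology[OF is_group assms(1)])
  then have "(arbitrary union_of pro_p_basic p G) (carrier G - H)"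
    by (simp add: openin_pro_p_topology[OF is_group assms(1)])
  moreover obtain x where "x \<in> carrier G - H" using assms(3) H.subset by blast
  ultimately obtain U where U: "pro_p_basic p G U" "U \<subseteq> carrier G - H" "x \<in> U"
    unfolding union_of_def by blast
  then obtain N g k where N: "N \<lhd> G" "card (rcosets N) = p ^ k" "g \<in> carrier G" "U = g <# N"
    by (auto simp: pro_p_basic_def p_power_index_normal_def)
  interpret N: normal N G by fact
  have "H <#> N = carrier G"
    using set_mult_p_power_index_normal[OF assms(1,2) top] N by blast
  then obtain h n where hn: "h \<in> H" "n \<in> N" "g = h \<otimes> n"
    using N(3) unfolding set_mult_def by blast
  then have "h = g \<otimes> inv n" by (simp add: m_assoc)
  then have "h \<in> U" using N hn unfolding l_coset_def by blast
  then show False using U hn by blast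
qed

section \<open>The graph of the witness and its properties\<close>

text \<open>The folded graph of \<open>\<langle>ab, ba\<^sup>2\<rangle>\<close>, where \<open>a\<close> is the generator \<open>True\<close>: two cycles at the
  vertex \<open>0\<close>, labelled \<open>ab\<close> and \<open>ba\<^sup>2\<close>.\<close>

definition graph_step :: "nat \<Rightarrow> bool letter \<Rightarrow> nat option" where
  "graph_step x l = map_of
    [((0, True, True), 1), ((1, False, True), 0),
     ((0, False, True), 2), ((2, True, True), 3), ((3, True, True), 0),
     ((1, True, False), 0), ((0, False, False), 1),
     ((2, False, False), 0), ((3, True, False), 2), ((0, True, False), 3)] (x, l)"

interpretation graph: inverse_automaton graph_step
proof
  fix x y l assume "graph_step x l = Some y"
  then show "graph_step y (letter_inv l) = Some x"
    by (auto simp: graph_step_def letter_inv_def split: if_splits)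
qed

text \<open>Reading positive letters moves pairs along the path
  \<open>{2, 3}, {0, 3}, {0, 1}, {0, 2}, {1, 3}\<close>, whose members are told apart by their sums.\<close>

definition pair_rank :: "nat \<Rightarrow> nat \<Rightarrow> nat" where
  "pair_rank x y = (let s = x + y in
    if s = 5 then 4 else if s = 3 then 3 else if s = 1 then 2 else if s = 2 then 1 else 0)"

lemma graph_step_positive:
  "graph_step x (True, True) = Some y \<longleftrightarrow> (x, y) \<in> {(0, 1), (2, 3), (3, 0)}"
  "graph_step x (False, True) = Some y \<longleftrightarrow> (x, y) \<in> {(1, 0), (0, 2)}"
  by (auto simp: graph_step_def)

text \<open>The vertices 1, 2 and 3 are interior to the two cycles, with one incoming and one
  outgoing edge each. Branching occurs only where the cycles meet.\<close>

lemma graph_branch_vertex: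
  "graph_step x (True, s) \<noteq> None \<Longrightarrow> graph_step x (False, s) \<noteq> None \<Longrightarrow> x = 0"
  by (cases s) (auto simp: graph_step_def split: if_splits)

lemma graph_no_common_loop:
  assumes "w \<in> graph.loops x" "w \<in> graph.loops y" "x \<noteq> y"
  shows "w = []"
proof (rule graph.no_common_loop[OF _ _ assms, of pair_rank])
  show "l = l'" if "x \<noteq> y" "graph_step x l \<noteq> None" "graph_step y l \<noteq> None"
    "graph_step x l' \<noteq> None" "graph_step y l' \<noteq> None" "snd l = snd l'" for x y l l'
  proof (rule ccontr)
    obtain a s a' where l: "l = (a, s)" "l' = (a', s)"
      using \<open>snd l = snd l'\<close> by (cases l; cases l') auto
    assume "l \<noteq> l'"
    then consider "a" "\<not> a'" | "\<not> a" "a'" using l by auto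
    \<comment> \<open>Two different letters of the same sign are readable at both vertices, so both
      are the branch vertex.\<close>
    then have "x = 0 \<and> y = 0"
      using that graph_branch_vertex l by cases auto
    then show False using \<open>x \<noteq> y\<close> by simp
  qed
  show "pair_rank x' y' < pair_rank x y" if "x \<noteq> y" "graph_step x (a, True) = Some x'"
    "graph_step y (a, True) = Some y'" for x y x' y' a
    using that
    by (cases a) (auto simp: graph_step_positive pair_rank_def)
qed

text \<open>In additive notation for the abelianization, (b + 2a) - (a + b) = a, and then (a + b) -
  a = b, so the two loops generate it. The commutator of \<open>b\<close> and the square of
  \<open>a\<close> lifts this computation to the free group.\<close>

lemma graph_loops_modulo_derived:
  assumes "subgroup L F2" "graph.loops 0 \<subseteq> L" "derived F2 (carrier F2) \<subseteq> L"
  shows "L = carrier F2"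
proof -
  interpret group F2 unfolding F2_def by (rule group_free_group)
  interpret L: subgroup L F2 by fact
  define a b :: "bool letter list" where "a = [(True, True)]" and "b = [(False, True)]"
  have car: "a \<in> carrier F2" "b \<in> carrier F2"
    by (auto simp: a_def b_def F2_def free_group_def reduced_def)
  have "a \<otimes>\<^bsub>F2\<^esub> b \<in> graph.loops 0" "b \<otimes>\<^bsub>F2\<^esub> (a \<otimes>\<^bsub>F2\<^esub> a) \<in> graph.loops 0"
    by (simp_all add: graph.loops_def a_def b_def F2_def free_group_def reduced_def
        letter_inv_def graph_step_def)
  then have ab: "a \<otimes>\<^bsub>F2\<^esub> b \<in> L" and baa: "b \<otimes>\<^bsub>F2\<^esub> (a \<otimes>\<^bsub>F2\<^esub> a) \<in> L" using assms by blast+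
  let ?c = "b \<otimes>\<^bsub>F2\<^esub> (a \<otimes>\<^bsub>F2\<^esub> a) \<otimes>\<^bsub>F2\<^esub> inv\<^bsub>F2\<^esub> b \<otimes>\<^bsub>F2\<^esub> inv\<^bsub>F2\<^esub> (a \<otimes>\<^bsub>F2\<^esub> a)"
  have "?c \<in> derived_set F2 (carrier F2)" using car by blast
  then have c: "?c \<in> L" using assms(3) unfolding derived_def by (blast intro: generate.incl)
  \<comment> \<open>The inverse of the commutator turns b a a into a a b, and the inverse of ab then
    cancels all but one \<open>a\<close>.\<close>
  have "a = inv\<^bsub>F2\<^esub> ?c \<otimes>\<^bsub>F2\<^esub> (b \<otimes>\<^bsub>F2\<^esub> (a \<otimes>\<^bsub>F2\<^esub> a) \<otimes>\<^bsub>F2\<^esub> inv\<^bsub>F2\<^esub> (a \<otimes>\<^bsub>F2\<^esub> b))"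
    using car by (simp add: inv_mult_group m_assoc inv_cancel)
  then have a: "a \<in> L" using ab baa c by (metis L.m_closed L.m_inv_closed)
  have "b = inv\<^bsub>F2\<^esub> a \<otimes>\<^bsub>F2\<^esub> (a \<otimes>\<^bsub>F2\<^esub> b)" using car by (simp add: inv_cancel)
  then have b: "b \<in> L" using a ab by (metis L.m_closed L.m_inv_closed)
  have "inv\<^bsub>F2\<^esub> a = [(True, False)]" "inv\<^bsub>F2\<^esub> b = [(False, False)]"
    by (simp_all add: F2_def inv_free_group a_def b_def reduced_def letter_inv_def)
  then have letter: "[l] \<in> L" for l
    using a b L.m_inv_closed[OF a] L.m_inv_closed[OF b] unfolding a_def b_def
    by (cases l; cases "fst l"; cases "snd l") auto
  have "w \<in> L" if "reduced w" for w
    using that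
  proof (induction w)
    case Nil
    then show ?case using L.one_closed by (simp add: F2_def free_group_def)
  next
    case (Cons l w)
    then have "w \<in> L" by (blast dest: reduced_ConsD)
    then have "[l] \<otimes>\<^bsub>F2\<^esub> w \<in> L" using letter by blast
    then show ?case using Cons.prems by (simp add: F2_def free_group_def push_Cons_reduced)
  qed
  then show ?thesis using L.subset by (auto simp: F2_def free_group_def)
qed

theorem theorem1p6:
  shows "\<exists>H. malnormal H F2 \<and>
    (\<forall>p::nat. prime p \<longrightarrow> \<not> closedin (pro_p_topology p F2) H)"
proof (intro exI conjI allI impI)
  show "malnormal (graph.loops 0) F2"
    unfolding F2_def using graph_no_common_loop by (rule graph.malnormal_loops)
  fix p :: nat assume "prime p"
  interpret group F2 unfolding F2_def by (rule group_free_group)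
  \<comment> \<open>The generator \<open>a\<close> leads from vertex 0 to vertex 1, so the group of
    loops is proper.\<close>
  have "[(True, True)] \<in> carrier F2 - graph.loops 0"
    by (simp add: F2_def free_group_def reduced_def graph.loops_def graph_step_def)
  then show "\<not> closedin (pro_p_topology p F2) (graph.loops 0)"
    using graph.subgroup_loops graph_loops_modulo_derived
    by (intro not_closedin_pro_p[OF \<open>prime p\<close>]) (auto simp: F2_def[symmetric])
qed

end
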